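(* Let $G=(V,E)$ be a locally finite connected graph, let $\Gamma$ be a closed nonunimodular subgroup of $\mathrm{Aut}(G)$ that acts transitively on $G$, and let the forests below be defined with the induced relative weight function $\mathbf{w}_\Gamma$. (1) If $\mathfrak{W}_{0+}(G,\boldsymbol{U})=\mathrm{FMSF}(G,\boldsymbol{U})$ (a.s.), then as $\beta\searrow0$ the local limit of $\mathfrak{F}_\beta(G,\boldsymbol{U})$ exists and is given by $\mathrm{FMSF}(G,\boldsymbol{U})$. (2) If $\mathrm{WMaxSF}(G,\boldsymbol{U})=\mathrm{FMaxSF}(G,\boldsymbol{U})$ (a.s.), then as $\beta\to\infty$ the local limit of $\mathfrak{F}_\beta(G,\boldsymbol{U})$ exists and is given by $\mathrm{FMaxSF}(G,\boldsymbol{U})$.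
   Context: Relative weights: $\mathbf{w}_\Gamma^y(x):=|\Gamma_x y|/|\Gamma_y x|$ for $x,y\in V$, where $\Gamma_v=\{\gamma\in\Gamma:\gamma v=v\}$. Changing the reference point $y$ multiplies $\mathbf{w}_\Gamma^y(\cdot)$ by a positive constant, which does not affect the orders below; fix $o\in V$ and write $\mathbf{w}=\mathbf{w}_\Gamma^o$. $\Gamma$ is nonunimodular if its left Haar measure is not right-invariant (equivalently, here, $\mathbf{w}_\Gamma$ is not constant). Forests: $\boldsymbol{U}=(U_e)_{e\in E}$ are i.i.d. $\mathrm{Uniform}[0,1]$ labels. For an edge $e=(x,y)$ put $\mathbf{w}(e)=\min\{\mathbf{w}(x),\mathbf{w}(y)\}$ and, for $\beta\in[0,\infty)$, $X_{e,\beta}=\mathbf{w}(e)^\beta(1-U_e)$. Define orders on $E$: $e\prec_0e'$ iff $1-U_e<1-U_{e'}$; $e\prec_{\mathbf{w}}e'$ iff $\mathbf{w}(e)<\mathbf{w}(e')$, or $\mathbf{w}(e)=\mathbf{w}(e')$ and $1-U_e<1-U_{e'}$; $e\prec_\beta e'$ iff $X_{e,\beta}<X_{e',\beta}$, or $X_{e,\beta}=X_{e',\beta}$ and $1-U_e<1-U_{e'}$. Almost surely these are linear orders for all $\beta\ge0$ simultaneously. For each order, the free forest is obtained from $G$ by simultaneously deleting the least edge in every finite cycle, and the wired forest is obtained by additionally deleting every edge that is least on some bi-infinite simple path. The free and wired forests are denoted $\mathrm{FMSF}(G,\boldsymbol{U})$, $\mathrm{WMSF}(G,\boldsymbol{U})$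 for $\prec_0$; $\mathrm{FMaxSF}(G,\boldsymbol{U})$, $\mathrm{WMaxSF}(G,\boldsymbol{U})$ for $\prec_{\mathbf{w}}$; $\mathfrak{F}_\beta(G,\boldsymbol{U})$, $\mathfrak{W}_\beta(G,\boldsymbol{U})$ for $\prec_\beta$. Local limit means almost sure limit in the product topology on $2^E$: almost surely, for every finite set of edges $K$, the forest agrees with the limit on $K$ for all $\beta>0$ sufficiently small (for $\beta\searrow0$), respectively all $\beta$ sufficiently large (for $\beta\to\infty$). All forests use the same labels $\boldsymbol{U}$. $\mathfrak{W}_{0+}(G,\boldsymbol{U})$ denotes the local limit of $\mathfrak{W}_\beta(G,\boldsymbol{U})$ as $\beta\searrow0$, which exists in this setting. *)

theory Defs
  imports "HOL-Probability.Probability" "HOL-Algebra.Bij"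
begin

section \<open>Graphs\<close>

text \<open>Graphs are simple and undirected: an edge is the two-element set of its endpoints.\<close>

definition simple_graph :: "'v set \<Rightarrow> 'v set set \<Rightarrow> bool" where
  "simple_graph V E \<longleftrightarrow> (\<forall>e\<in>E. e \<subseteq> V \<and> card e = 2)"

definition locally_finite_graph :: "'v set \<Rightarrow> 'v set set \<Rightarrow> bool" where
  "locally_finite_graph V E \<longleftrightarrow> (\<forall>x\<in>V. finite {e \<in> E. x \<in> e})"

definition connected_graph :: "'v set \<Rightarrow> 'v set set \<Rightarrow> bool" where
  "connected_graph V E \<longleftrightarrow> V \<noteq> {} \<and> (\<forall>x\<in>V. \<forall>y\<in>V. (x, y) \<in> {(a, b). {a, b} \<in> E}\<^sup>*)"

definition cycles :: "'v set set \<Rightarrow> 'v set set set" where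
  "cycles E = {(\<lambda>i. {xs ! i, xs ! (Suc i mod length xs)}) ` {..<length xs} | xs.
     3 \<le> length xs \<and> distinct xs \<and> (\<forall>i<length xs. {xs ! i, xs ! (Suc i mod length xs)} \<in> E)}"

definition biinfinite_paths :: "'v set set \<Rightarrow> 'v set set set" where
  "biinfinite_paths E = {range (\<lambda>i. {p i, p (i + 1)}) | p :: int \<Rightarrow> 'v.
     inj p \<and> (\<forall>i. {p i, p (i + 1)} \<in> E)}"

section \<open>Automorphism groups\<close>

text \<open>
  As in \<^const>\<open>BijGroup\<close>, permutations of \<open>V\<close> are functions that are \<^const>\<open>undefined\<close> outside \<open>V\<close>.
  These are exactly the points of the product topology on \<open>V \<rightarrow> V\<close> with \<open>V\<close> discrete, which induces
  the topology of pointwise convergence.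
\<close>

definition graph_automorphisms :: "'v set \<Rightarrow> 'v set set \<Rightarrow> ('v \<Rightarrow> 'v) set" where
  "graph_automorphisms V E = {g \<in> Bij V. \<forall>x\<in>V. \<forall>y\<in>V. {g x, g y} \<in> E \<longleftrightarrow> {x, y} \<in> E}"

definition perm_group :: "'v set \<Rightarrow> ('v \<Rightarrow> 'v) set \<Rightarrow> ('v \<Rightarrow> 'v) monoid" where
  "perm_group V \<Gamma> = (BijGroup V)\<lparr>carrier := \<Gamma>\<rparr>"

definition perm_topology :: "'v set \<Rightarrow> ('v \<Rightarrow> 'v) set \<Rightarrow> ('v \<Rightarrow> 'v) topology" where
  "perm_topology V \<Gamma> = subtopology (product_topology (\<lambda>_. discrete_topology V) V) \<Gamma>"

definition transitive_on :: "'v set \<Rightarrow> ('v \<Rightarrow> 'v) set \<Rightarrow> bool" where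
  "transitive_on V \<Gamma> \<longleftrightarrow> (\<forall>x\<in>V. \<forall>y\<in>V. \<exists>\<gamma>\<in>\<Gamma>. \<gamma> x = y)"

section \<open>Haar measure and unimodularity\<close>

text \<open>A left Haar measure is a nonzero left-invariant Radon measure on the Borel sets.\<close>

definition left_haar_measure :: "('g, 'm) monoid_scheme \<Rightarrow> 'g topology \<Rightarrow> 'g measure \<Rightarrow> bool" where
  "left_haar_measure G T \<mu> \<longleftrightarrow>
     space \<mu> = carrier G \<and>
     sets \<mu> = sigma_sets (carrier G) {S. openin T S} \<and>
     emeasure \<mu> (carrier G) \<noteq> 0 \<and>
     (\<forall>K. compactin T K \<longrightarrow> emeasure \<mu> K < \<infinity>) \<and>
     (\<forall>A\<in>sets \<mu>. emeasure \<mu> A = (INF S\<in>{S. openin T S \<and> A \<subseteq> S}. emeasure \<mu> S)) \<and>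
     (\<forall>S. openin T S \<longrightarrow> emeasure \<mu> S = (SUP K\<in>{K. compactin T K \<and> K \<subseteq> S}. emeasure \<mu> K)) \<and>
     (\<forall>g\<in>carrier G. \<forall>A\<in>sets \<mu>. emeasure \<mu> ((\<lambda>h. g \<otimes>\<^bsub>G\<^esub> h) ` A) = emeasure \<mu> A)"

definition right_invariant :: "('g, 'm) monoid_scheme \<Rightarrow> 'g measure \<Rightarrow> bool" where
  "right_invariant G \<mu> \<longleftrightarrow>
     (\<forall>g\<in>carrier G. \<forall>A\<in>sets \<mu>. emeasure \<mu> ((\<lambda>h. h \<otimes>\<^bsub>G\<^esub> g) ` A) = emeasure \<mu> A)"

text \<open>By uniqueness of Haar measure up to scaling, the choice of \<open>\<mu>\<close> is irrelevant.\<close>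

definition nonunimodular :: "('g, 'm) monoid_scheme \<Rightarrow> 'g topology \<Rightarrow> bool" where
  "nonunimodular G T \<longleftrightarrow> (\<exists>\<mu>. left_haar_measure G T \<mu> \<and> \<not> right_invariant G \<mu>)"

section \<open>Relative weights\<close>

definition stab :: "('v \<Rightarrow> 'v) set \<Rightarrow> 'v \<Rightarrow> ('v \<Rightarrow> 'v) set" where
  "stab \<Gamma> x = {\<gamma> \<in> \<Gamma>. \<gamma> x = x}"

definition rel_weight :: "('v \<Rightarrow> 'v) set \<Rightarrow> 'v \<Rightarrow> 'v \<Rightarrow> real" where
  "rel_weight \<Gamma> y x = real (card ((\<lambda>\<gamma>. \<gamma> y) ` stab \<Gamma> x)) / real (card ((\<lambda>\<gamma>. \<gamma> x) ` stab \<Gamma> y))"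

definition edge_weight :: "('v \<Rightarrow> real) \<Rightarrow> 'v set \<Rightarrow> real" where
  "edge_weight w e = Min (w ` e)"

section \<open>Edge orders and forests\<close>

text \<open>Here \<open>u\<close> is a realisation of the edge labels, and each \<open>order\<close> relates \<open>e\<close> to \<open>e'\<close> iff \<open>e \<prec> e'\<close>.\<close>

definition order_0 :: "('v set \<Rightarrow> real) \<Rightarrow> 'v set \<Rightarrow> 'v set \<Rightarrow> bool" where
  "order_0 u e e' \<longleftrightarrow> 1 - u e < 1 - u e'"

definition order_w :: "('v \<Rightarrow> real) \<Rightarrow> ('v set \<Rightarrow> real) \<Rightarrow> 'v set \<Rightarrow> 'v set \<Rightarrow> bool" where
  "order_w w u e e' \<longleftrightarrow> edge_weight w e < edge_weight w e' \<or>
     edge_weight w e = edge_weight w e' \<and> 1 - u e < 1 - u e'"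

definition X_beta :: "('v \<Rightarrow> real) \<Rightarrow> real \<Rightarrow> ('v set \<Rightarrow> real) \<Rightarrow> 'v set \<Rightarrow> real" where
  "X_beta w \<beta> u e = edge_weight w e powr \<beta> * (1 - u e)"

definition order_beta ::
    "('v \<Rightarrow> real) \<Rightarrow> real \<Rightarrow> ('v set \<Rightarrow> real) \<Rightarrow> 'v set \<Rightarrow> 'v set \<Rightarrow> bool" where
  "order_beta w \<beta> u e e' \<longleftrightarrow> X_beta w \<beta> u e < X_beta w \<beta> u e' \<or>
     X_beta w \<beta> u e = X_beta w \<beta> u e' \<and> 1 - u e < 1 - u e'"

definition least_in :: "('e \<Rightarrow> 'e \<Rightarrow> bool) \<Rightarrow> 'e set \<Rightarrow> 'e \<Rightarrow> bool" where
  "least_in prec C e \<longleftrightarrow> e \<in> C \<and> (\<forall>e'\<in>C - {e}. prec e e')"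

definition free_forest :: "'v set set \<Rightarrow> ('v set \<Rightarrow> 'v set \<Rightarrow> bool) \<Rightarrow> 'v set set" where
  "free_forest E prec = {e \<in> E. \<not> (\<exists>C\<in>cycles E. least_in prec C e)}"

definition wired_forest :: "'v set set \<Rightarrow> ('v set \<Rightarrow> 'v set \<Rightarrow> bool) \<Rightarrow> 'v set set" where
  "wired_forest E prec = {e \<in> free_forest E prec. \<not> (\<exists>P\<in>biinfinite_paths E. least_in prec P e)}"

definition FMSF :: "'v set set \<Rightarrow> ('v set \<Rightarrow> real) \<Rightarrow> 'v set set" where
  "FMSF E u = free_forest E (order_0 u)"

definition FMaxSF :: "'v set set \<Rightarrow> ('v \<Rightarrow> real) \<Rightarrow> ('v set \<Rightarrow> real) \<Rightarrow> 'v set set" where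
  "FMaxSF E w u = free_forest E (order_w w u)"

definition WMaxSF :: "'v set set \<Rightarrow> ('v \<Rightarrow> real) \<Rightarrow> ('v set \<Rightarrow> real) \<Rightarrow> 'v set set" where
  "WMaxSF E w u = wired_forest E (order_w w u)"

definition F_beta :: "'v set set \<Rightarrow> ('v \<Rightarrow> real) \<Rightarrow> real \<Rightarrow> ('v set \<Rightarrow> real) \<Rightarrow> 'v set set" where
  "F_beta E w \<beta> u = free_forest E (order_beta w \<beta> u)"

definition W_beta :: "'v set set \<Rightarrow> ('v \<Rightarrow> real) \<Rightarrow> real \<Rightarrow> ('v set \<Rightarrow> real) \<Rightarrow> 'v set set" where
  "W_beta E w \<beta> u = wired_forest E (order_beta w \<beta> u)"

text \<open>Convergence in the product topology on the subsets of \<open>E\<close>, for one realisation of the labels.\<close>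

definition is_local_limit :: "'e set \<Rightarrow> (real \<Rightarrow> 'e set) \<Rightarrow> 'e set \<Rightarrow> real filter \<Rightarrow> bool" where
  "is_local_limit E S L F \<longleftrightarrow>
     L \<subseteq> E \<and> (\<forall>K\<subseteq>E. finite K \<longrightarrow> (\<forall>\<^sub>F \<beta> in F. S \<beta> \<inter> K = L \<inter> K))"

section \<open>Labels\<close>

definition iid_uniform_labels :: "'a measure \<Rightarrow> 'e set \<Rightarrow> ('e \<Rightarrow> 'a \<Rightarrow> real) \<Rightarrow> bool" where
  "iid_uniform_labels M E U \<longleftrightarrow> prob_space M \<and>
     prob_space.indep_vars M (\<lambda>_. borel) U E \<and>
     (\<forall>e\<in>E. distr M borel (U e) = uniform_measure lborel {0..1})"

end

theory Submission
  imports Defs "HOL-Library.Diagonal_Subsequence"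
begin

text \<open>
  Both parts are deterministic: they hold for every realisation of the labels that satisfies the
  hypothesis on the forests and, in the second part, has all labels below \<open>1\<close>. The other input is that
  all weights are positive, because the stabilisers of a locally finite connected graph have finite
  orbits.

  An edge outside the limiting free forest is least in a finite cycle. As \<open>\<beta>\<close> tends to its limit, each
  of the finitely many strict comparisons on this cycle eventually holds for \<^const>\<open>order_beta\<close> as
  well, so the edge is eventually deleted (\<open>eventually_not_in_free_forest\<close>).

  Conversely, an edge of the limiting free forest has to be kept eventually. For \<open>\<beta>\<close> near \<open>0\<close> the
  hypothesis gives this: the edge lies in the limit of the wired forests, and a wired forest is
  contained in the free one. For \<open>\<beta>\<close> near infinity, suppose that the edge \<open>e\<close> is least in cycles
  \<open>C\<^sub>n\<close> for \<open>\<beta>\<^sub>n\<close> tending to infinity. By local finiteness, a subsequence of the \<open>C\<^sub>n\<close> converges to a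
  cycle or to a bi-infinite path through \<open>e\<close> (\<open>cycles_accumulate\<close>). Every edge of the limit lies in
  \<open>C\<^sub>n\<close> for infinitely many \<open>n\<close>, and this forces \<open>e\<close> to be least on the limit for \<^const>\<open>order_w\<close>. So
  \<open>e\<close> is not in the wired forest of \<^const>\<open>order_w\<close>, which is assumed to equal the free one.
\<close>

section \<open>Locally finite graphs\<close>

lemma finite_neighbours:
  assumes "simple_graph V E" "locally_finite_graph V E"
  shows "finite {y. {x, y} \<in> E}"
proof (cases "x \<in> V")
  case True
  have "(\<lambda>y. {x, y}) ` {y. {x, y} \<in> E} \<subseteq> {e \<in> E. x \<in> e}" by auto
  moreover have "finite {e \<in> E. x \<in> e}"
    using assms(2) True by (auto simp: locally_finite_graph_def)
  ultimately have "finite ((\<lambda>y. {x, y}) ` {y. {x, y} \<in> E})" by (rule finite_subset)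
  moreover have "inj_on (\<lambda>y. {x, y}) {y. {x, y} \<in> E}"
    by (auto simp: inj_on_def doubleton_eq_iff)
  ultimately show ?thesis by (rule finite_imageD)
next
  case False
  then have "{y. {x, y} \<in> E} = {}"
    using assms(1) by (auto simp: simple_graph_def)
  then show ?thesis by simp
qed

lemma countable_edges:
  assumes "simple_graph V E" "locally_finite_graph V E" "connected_graph V E"
  shows "countable E"
proof -
  let ?R = "{(a, b). {a, b} \<in> E}"
  obtain x where x: "x \<in> V" using assms(3) by (auto simp: connected_graph_def)
  have "countable (?R `` Y)" if "countable Y" for Y
  proof -
    have "?R `` Y = (\<Union>y\<in>Y. {z. {y, z} \<in> E})" by auto
    then show ?thesis
      using that finite_neighbours[OF assms(1,2)] by (simp add: countable_finite)
  qed
  then have "countable (?R\<^sup>* `` {x})" by (rule countable_rtrancl) (simp_all add: countable_finite)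
  moreover have "V \<subseteq> ?R\<^sup>* `` {x}" using assms(3) x by (auto simp: connected_graph_def)
  ultimately have V: "countable V" by (rule countable_subset[rotated])
  have "\<exists>x\<in>V. x \<in> e" if "e \<in> E" for e
  proof -
    have "e \<subseteq> V" "e \<noteq> {}" using assms(1) that by (auto simp: simple_graph_def)
    then show ?thesis by blast
  qed
  then have "E \<subseteq> (\<Union>x\<in>V. {e \<in> E. x \<in> e})" by blast
  moreover have "countable (\<Union>x\<in>V. {e \<in> E. x \<in> e})"
    using V assms(2) by (auto simp: locally_finite_graph_def intro: countable_finite)
  ultimately show ?thesis by (rule countable_subset)
qed

section \<open>Positivity of the weights\<close>

text \<open>
  A stabiliser preserves the distance to its fixed point, so it moves every vertex within a ball,
  which is finite. Without this, the cardinality \<open>0\<close> of an infinite orbit could make a weight vanish.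
\<close>

lemma finite_stab_orbit:
  assumes "simple_graph V E" "locally_finite_graph V E" "connected_graph V E"
    and "\<Gamma> \<subseteq> graph_automorphisms V E" "x \<in> V" "y \<in> V"
  shows "finite ((\<lambda>\<gamma>. \<gamma> y) ` stab \<Gamma> x)"
proof -
  have "(x, y) \<in> {(a, b). {a, b} \<in> E}\<^sup>*"
    using assms(3,5,6) by (auto simp: connected_graph_def)
  then show ?thesis
  proof induction
    case base
    have "(\<lambda>\<gamma>. \<gamma> x) ` stab \<Gamma> x \<subseteq> {x}" by (auto simp: stab_def)
    then show ?case by (rule finite_subset) simp
  next
    case (step y z)
    have yz: "{y, z} \<in> E" using step by auto
    then have "y \<in> V" "z \<in> V" using assms(1) by (auto simp: simple_graph_def)
    then have "{\<gamma> y, \<gamma> z} \<in> E" if "\<gamma> \<in> stab \<Gamma> x" for \<gamma>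
      using that assms(4) yz by (auto simp: stab_def graph_automorphisms_def)
    then have "(\<lambda>\<gamma>. \<gamma> z) ` stab \<Gamma> x \<subseteq> (\<Union>v\<in>(\<lambda>\<gamma>. \<gamma> y) ` stab \<Gamma> x. {u. {v, u} \<in> E})" by auto
    moreover have "finite (\<Union>v\<in>(\<lambda>\<gamma>. \<gamma> y) ` stab \<Gamma> x. {u. {v, u} \<in> E})"
      using step.IH finite_neighbours[OF assms(1,2)] by blast
    ultimately show ?case by (rule finite_subset)
  qed
qed

lemma rel_weight_pos:
  assumes "simple_graph V E" "locally_finite_graph V E" "connected_graph V E"
    and "subgroup \<Gamma> (perm_group V (graph_automorphisms V E))" "x \<in> V" "y \<in> V"
  shows "0 < rel_weight \<Gamma> y x"
proof -
  have sub: "\<Gamma> \<subseteq> graph_automorphisms V E"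
    using subgroup.subset[OF assms(4)] by (simp add: perm_group_def)
  have one: "(\<lambda>v\<in>V. v) \<in> \<Gamma>"
    using subgroup.one_closed[OF assms(4)] by (simp add: perm_group_def BijGroup_def)
  have "0 < card ((\<lambda>\<gamma>. \<gamma> b) ` stab \<Gamma> a)" if "a \<in> V" "b \<in> V" for a b
  proof -
    have "(\<lambda>v\<in>V. v) \<in> stab \<Gamma> a" using one that by (simp add: stab_def)
    then show ?thesis
      using finite_stab_orbit[OF assms(1-3) sub that] by (auto simp: card_gt_0_iff)
  qed
  then show ?thesis using assms(5,6) by (simp add: rel_weight_def)
qed

lemma edge_weight_pos:
  assumes "simple_graph V E" "e \<in> E" "\<And>x. x \<in> V \<Longrightarrow> 0 < w x"
  shows "0 < edge_weight w e"
proof -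
  have e: "e \<subseteq> V" "card e = 2" using assms(1,2) by (auto simp: simple_graph_def)
  then have "finite e" "e \<noteq> {}" by (auto intro: card_ge_0_finite)
  then show ?thesis using e(1) assms(3) by (auto simp: edge_weight_def)
qed

section \<open>Comparison of the orders\<close>

lemma order_0_imp_eventually_order_beta:
  assumes "0 < edge_weight w e" "0 < edge_weight w e'" "order_0 u e e'"
  shows "\<forall>\<^sub>F \<beta> in at_right 0. order_beta w \<beta> u e e'"
proof -
  have "((\<lambda>\<beta>. edge_weight w f powr \<beta>) \<longlongrightarrow> edge_weight w f powr 0) (at_right 0)"
    if "0 < edge_weight w f" for f
    using that by (intro tendsto_intros) auto
  then have "((\<lambda>\<beta>. X_beta w \<beta> u f) \<longlongrightarrow> 1 - u f) (at_right 0)" if "0 < edge_weight w f" for f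
    unfolding X_beta_def using that tendsto_mult[OF _ tendsto_const] by fastforce
  then have "((\<lambda>\<beta>. X_beta w \<beta> u e' - X_beta w \<beta> u e) \<longlongrightarrow> (1 - u e') - (1 - u e)) (at_right 0)"
    using assms by (intro tendsto_diff) auto
  then have "\<forall>\<^sub>F \<beta> in at_right 0. 0 < X_beta w \<beta> u e' - X_beta w \<beta> u e"
    using assms(3) by (intro order_tendstoD(1)) (auto simp: order_0_def)
  then show ?thesis by eventually_elim (auto simp: order_beta_def)
qed

lemma powr_tendsto_0_at_top:
  fixes r :: real
  assumes "0 < r" "r < 1"
  shows "((\<lambda>\<beta>. r powr \<beta>) \<longlongrightarrow> 0) at_top"
proof -
  have "filterlim (\<lambda>\<beta>. ln r * \<beta>) at_bot at_top"
    using assms by (intro filterlim_tendsto_neg_mult_at_bot[OF tendsto_const _ filterlim_ident]) auto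
  then have "((\<lambda>\<beta>. exp (ln r * \<beta>)) \<longlongrightarrow> 0) at_top"
    by (rule filterlim_compose[OF exp_at_bot])
  then show ?thesis using assms by (simp add: powr_def mult.commute)
qed

text \<open>
  A strict difference of the weights is amplified geometrically by the power \<open>\<beta>\<close> and beats any fixed
  ratio of the factors \<open>1 - u e\<close> and \<open>1 - u e'\<close>, as long as the latter is not \<open>0\<close>.
\<close>

lemma order_w_imp_eventually_order_beta:
  assumes "0 < edge_weight w e" "0 < edge_weight w e'" "u e' < 1" "order_w w u e e'"
  shows "\<forall>\<^sub>F \<beta> in at_top. order_beta w \<beta> u e e'"
proof (cases "edge_weight w e < edge_weight w e'")
  case True
  define r where "r = edge_weight w e / edge_weight w e'"
  have "((\<lambda>\<beta>. r powr \<beta> * (1 - u e)) \<longlongrightarrow> 0 * (1 - u e)) at_top"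
    using assms True by (intro tendsto_mult powr_tendsto_0_at_top) (auto simp: r_def)
  then have "\<forall>\<^sub>F \<beta> in at_top. r powr \<beta> * (1 - u e) < 1 - u e'"
    using assms(3) by (intro order_tendstoD(2)) auto
  then show ?thesis
  proof eventually_elim
    case (elim \<beta>)
    have "X_beta w \<beta> u e = edge_weight w e' powr \<beta> * (r powr \<beta> * (1 - u e))"
      using assms(1,2) by (simp add: X_beta_def r_def powr_divide)
    also have "\<dots> < edge_weight w e' powr \<beta> * (1 - u e')"
      using elim assms(2) by (intro mult_strict_left_mono) auto
    finally show ?case by (simp add: order_beta_def X_beta_def)
  qed
next
  case False
  then show ?thesis
    using assms by (intro always_eventually allI) (auto simp: order_w_def order_beta_def X_beta_def)
qed

text \<open>
  If \<open>e'\<close> has strictly smaller weight than \<open>e\<close>, it eventually comes first. If the weights agree, both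
  orders compare the labels, for every \<open>\<beta>\<close>.
\<close>

lemma not_order_w_imp_eventually_not_order_beta:
  assumes "0 < edge_weight w e" "0 < edge_weight w e'" "u e < 1" "\<not> order_w w u e e'"
  shows "\<forall>\<^sub>F \<beta> in at_top. \<not> order_beta w \<beta> u e e'"
proof (cases "edge_weight w e' < edge_weight w e")
  case True
  then have "\<forall>\<^sub>F \<beta> in at_top. order_beta w \<beta> u e' e"
    using assms by (intro order_w_imp_eventually_order_beta) (auto simp: order_w_def)
  then show ?thesis by eventually_elim (auto simp: order_beta_def)
next
  case False
  then have "edge_weight w e = edge_weight w e'" "\<not> 1 - u e < 1 - u e'"
    using assms(4) by (auto simp: order_w_def)
  then show ?thesis
    using assms(1) by (intro always_eventually allI) (auto simp: order_beta_def X_beta_def)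
qed

section \<open>Deletions persist in the limit\<close>

lemma finite_cycle: "C \<in> cycles E \<Longrightarrow> finite C"
  by (auto simp: cycles_def)

lemma cycle_subset_edges: "C \<in> cycles E \<Longrightarrow> C \<subseteq> E"
  by (auto simp: cycles_def)

text \<open>
  The cycle that deletes \<open>e\<close> is finite, so finitely many comparisons, each of which holds eventually,
  keep deleting it.
\<close>

lemma eventually_not_in_free_forest:
  assumes "e \<in> E" "e \<notin> free_forest E prec"
    and "\<And>e'. e' \<in> E \<Longrightarrow> prec e e' \<Longrightarrow> \<forall>\<^sub>F \<beta> in F. prec' \<beta> e e'"
  shows "\<forall>\<^sub>F \<beta> in F. e \<notin> free_forest E (prec' \<beta>)"
proof -
  obtain C where C: "C \<in> cycles E" "least_in prec C e"
    using assms(1,2) by (auto simp: free_forest_def)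
  have "\<forall>\<^sub>F \<beta> in F. \<forall>e'\<in>C - {e}. prec' \<beta> e e'"
    using C assms(3) finite_cycle[OF C(1)] cycle_subset_edges[OF C(1)]
    by (intro eventually_ball_finite) (auto simp: least_in_def)
  then show ?thesis
    by eventually_elim (use C in \<open>auto simp: free_forest_def least_in_def\<close>)
qed

lemma is_local_limitI:
  assumes "L \<subseteq> E" "\<And>e. e \<in> L \<Longrightarrow> \<forall>\<^sub>F \<beta> in F. e \<in> S \<beta>"
    and "\<And>e. e \<in> E \<Longrightarrow> e \<notin> L \<Longrightarrow> \<forall>\<^sub>F \<beta> in F. e \<notin> S \<beta>"
  shows "is_local_limit E S L F"
  unfolding is_local_limit_def
proof (intro conjI allI impI)
  fix K assume K: "K \<subseteq> E" "finite K"
  have "\<forall>\<^sub>F \<beta> in F. e \<in> S \<beta> \<longleftrightarrow> e \<in> L" if "e \<in> E" for e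
    using assms(2)[of e] assms(3)[of e] that by (cases "e \<in> L") auto
  then have "\<forall>\<^sub>F \<beta> in F. \<forall>e\<in>K. e \<in> S \<beta> \<longleftrightarrow> e \<in> L"
    using K by (intro eventually_ball_finite) auto
  then show "\<forall>\<^sub>F \<beta> in F. S \<beta> \<inter> K = L \<inter> K" by eventually_elim auto
qed (rule assms(1))

lemma is_local_limit_eventually_mem:
  assumes "is_local_limit E S L F" "e \<in> L"
  shows "\<forall>\<^sub>F \<beta> in F. e \<in> S \<beta>"
proof -
  have "{e} \<subseteq> E" using assms by (auto simp: is_local_limit_def)
  then have "\<forall>\<^sub>F \<beta> in F. S \<beta> \<inter> {e} = L \<inter> {e}"
    using assms(1) unfolding is_local_limit_def by blast
  then show ?thesis by eventually_elim (use assms(2) in auto)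
qed

section \<open>Limits of cycles through an edge\<close>

text \<open>
  A cycle through \<open>e\<close> is unrolled to a periodic walk starting along \<open>e\<close>, so that cycles of all
  lengths become functions on the same index set and can be compared with bi-infinite paths. The
  range over all integers shows at once that every step of the walk lies on \<open>C\<close>; the image of the
  window \<open>{0..L}\<close>, which covers a full period, shows that finitely many values of \<open>p\<close> determine \<open>C\<close>.
\<close>

definition unrolls_to :: "'v set set \<Rightarrow> 'v set \<Rightarrow> 'v set set \<Rightarrow> (int \<Rightarrow> 'v) \<Rightarrow> nat \<Rightarrow> bool" where
  "unrolls_to E e C p L \<longleftrightarrow>
     (\<forall>i. {p i, p (i + 1)} \<in> E) \<and> (\<forall>i j. p i = p j \<longleftrightarrow> i mod int L = j mod int L) \<and>
     C = range (\<lambda>i. {p i, p (i + 1)}) \<and> C = (\<lambda>i. {p i, p (i + 1)}) ` {0..int L} \<and>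
     e = {p 0, p 1}"

lemma cycle_unrolls:
  fixes E :: "'v set set"
  assumes "C \<in> cycles E" "e \<in> C"
  shows "\<exists>p L. unrolls_to E e C p L"
proof -
  obtain xs :: "'v list" where C: "C = (\<lambda>i. {xs ! i, xs ! (Suc i mod length xs)}) ` {..<length xs}"
    and xs: "3 \<le> length xs" "distinct xs"
      "\<forall>i<length xs. {xs ! i, xs ! (Suc i mod length xs)} \<in> E"
    using assms(1) by (auto simp: cycles_def)
  define L where "L = length xs"
  have L: "0 < L" using xs(1) by (auto simp: L_def)
  obtain k where k: "k < L" "e = {xs ! k, xs ! (Suc k mod L)}"
    using assms(2) C by (auto simp: L_def)
  \<comment> \<open>The position in \<open>xs\<close> after \<open>i\<close> steps from the position \<open>k\<close> at which \<open>e\<close> is traversed.\<close>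
  define r where "r i = nat ((i + int k) mod int L)" for i
  define p where "p i = xs ! r i" for i
  have r: "r i < L" for i using L by (simp add: r_def nat_less_iff)
  have r_Suc: "r (i + 1) = Suc (r i) mod L" for i
  proof -
    have "int (Suc (r i) mod L) = ((i + int k) mod int L + 1) mod int L"
      using L by (simp add: r_def zmod_int add.commute)
    also have "\<dots> = int (r (i + 1))"
      using L by (simp add: r_def mod_simps ac_simps)
    finally show ?thesis by simp
  qed
  have edge: "{p i, p (i + 1)} = {xs ! r i, xs ! (Suc (r i) mod L)}" for i
    by (simp add: p_def r_Suc)
  have r_surj: "\<exists>i\<in>{0..int L}. r i = j" if "j < L" for j
  proof
    let ?i = "(int j - int k) mod int L"
    show "?i \<in> {0..int L}" using L by (simp add: less_imp_le)
    have "(?i + int k) mod int L = int j mod int L" by (simp add: mod_simps)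
    then show "r ?i = j" using that by (simp add: r_def)
  qed
  have C_le: "C \<subseteq> (\<lambda>i. {p i, p (i + 1)}) ` {0..int L}"
  proof
    fix f assume "f \<in> C"
    then obtain j where j: "j < L" "f = {xs ! j, xs ! (Suc j mod L)}" by (auto simp: C L_def)
    then obtain i where "i \<in> {0..int L}" "r i = j" using r_surj by blast
    then show "f \<in> (\<lambda>i. {p i, p (i + 1)}) ` {0..int L}" using j(2) edge[of i] by auto
  qed
  have C_ge: "{p i, p (i + 1)} \<in> C" for i
    unfolding C edge using r[of i] by (auto simp: L_def)
  have "unrolls_to E e C p L"
    unfolding unrolls_to_def
  proof (intro conjI allI)
    show "{p i, p (i + 1)} \<in> E" for i
      using xs(3) r[of i] by (simp add: edge L_def)
    show "p i = p j \<longleftrightarrow> i mod int L = j mod int L" for i j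
    proof -
      have "p i = p j \<longleftrightarrow> r i = r j"
        using r xs(2) by (simp add: p_def nth_eq_iff_index_eq L_def)
      also have "\<dots> \<longleftrightarrow> (i + int k) mod int L = (j + int k) mod int L"
        using L by (simp add: r_def eq_nat_nat_iff)
      also have "\<dots> \<longleftrightarrow> i mod int L = j mod int L"
        by (simp add: mod_eq_dvd_iff)
      finally show ?thesis .
    qed
    show "C = range (\<lambda>i. {p i, p (i + 1)})" using C_le C_ge by auto
    show "C = (\<lambda>i. {p i, p (i + 1)}) ` {0..int L}" using C_le C_ge by auto
    show "e = {p 0, p 1}" using edge[of 0] k by (simp add: r_def)
  qed
  then show ?thesis by blast
qed

text \<open>Sequential compactness of a countable product of finite sets.\<close>

lemma pointwise_stabilising_subsequence:
  fixes f :: "nat \<Rightarrow> 'i::countable \<Rightarrow> 'b"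
  assumes "\<And>i. finite (range (\<lambda>n. f n i))"
  obtains r g where "strict_mono (r :: nat \<Rightarrow> nat)" "\<And>i. \<forall>\<^sub>F n in sequentially. f (r n) i = g i"
proof -
  \<comment> \<open>The diagonal sequence is built from successive subsequences, the \<open>k\<close>-th of which makes the
    \<open>k\<close>-th coordinate constant.\<close>
  let ?P = "\<lambda>k (s :: nat \<Rightarrow> nat). \<exists>v. \<forall>n. f (s n) (from_nat k) = v"
  interpret subseqs ?P
  proof
    fix k and s :: "nat \<Rightarrow> nat"
    have "finite (range (\<lambda>n. f (s n) (from_nat k)))"
      using assms by (rule finite_subset[rotated]) auto
    then obtain v where "infinite ((\<lambda>n. f (s n) (from_nat k)) -` {v})"
      using inf_img_fin_dom[of "\<lambda>n. f (s n) (from_nat k)" UNIV] by auto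
    then obtain r' :: "nat \<Rightarrow> nat" where "strict_mono r'"
      "\<forall>n. r' n \<in> (\<lambda>n. f (s n) (from_nat k)) -` {v}"
      using infinite_enumerate by blast
    then show "\<exists>r'. strict_mono r' \<and> ?P k (s \<circ> r')" by auto
  qed
  have stable: "?P k (s \<circ> r)" if "?P k s" for k r and s :: "nat \<Rightarrow> nat"
    using that by auto
  have "\<exists>v. \<forall>\<^sub>F n in sequentially. f (diagseq n) i = v" for i
  proof -
    obtain v where "\<forall>n. f ((diagseq \<circ> (+) (Suc (to_nat i))) n) (from_nat (to_nat i)) = v"
      using diagseq_holds[of "to_nat i"] stable by blast
    then have v: "f (diagseq (Suc (to_nat i) + n)) i = v" for n by simp
    have "f (diagseq n) i = v" if "Suc (to_nat i) \<le> n" for n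
      using v[of "n - Suc (to_nat i)"] that by simp
    then show ?thesis unfolding eventually_sequentially by blast
  qed
  then have "\<exists>g. \<forall>i. \<forall>\<^sub>F n in sequentially. f (diagseq n) i = g i" by (intro choice allI)
  then obtain g where "\<forall>i. \<forall>\<^sub>F n in sequentially. f (diagseq n) i = g i" ..
  with subseq_diagseq show thesis by (intro that) auto
qed

text \<open>
  Cycles through \<open>e\<close> that get longer and longer open up to a bi-infinite path through \<open>e\<close>; if their
  lengths do not tend to infinity, one and the same cycle recurs.
\<close>

lemma cycles_accumulate:
  assumes "simple_graph V E" "locally_finite_graph V E"
    and C: "\<And>n. C n \<in> cycles E" "\<And>n::nat. e \<in> C n"
  obtains D where "D \<in> cycles E \<union> biinfinite_paths E" "e \<in> D"
    "\<And>f. f \<in> D \<Longrightarrow> \<exists>\<^sub>F n in sequentially. f \<in> C n"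
proof -
  have "\<forall>n. \<exists>p L. unrolls_to E e (C n) p L" using cycle_unrolls[OF C] by blast
  then obtain p L where unroll: "\<And>n. unrolls_to E e (C n) (p n) (L n)" by metis
  then have p_edge: "\<And>n i. {p n i, p n (i + 1)} \<in> E"
    and p_eq: "\<And>n i j. p n i = p n j \<longleftrightarrow> i mod int (L n) = j mod int (L n)"
    and p_e: "\<And>n. e = {p n 0, p n 1}"
    by (auto simp: unrolls_to_def)
  have C_range: "C n = range (\<lambda>i. {p n i, p n (i + 1)})"
    and C_image: "C n = (\<lambda>i. {p n i, p n (i + 1)}) ` {0..int (L n)}" for n
    using unroll[of n] unfolding unrolls_to_def by blast+
  \<comment> \<open>All walks start in \<open>e\<close> and move to a neighbour, so by local finiteness each coordinate takes
    finitely many values.\<close>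
  have "finite (range (\<lambda>n. p n i))" for i
  proof (induction i rule: int_induct[where k = "0::int"])
    case base
    have "range (\<lambda>n. p n 0) \<subseteq> e" using p_e by auto
    moreover have "finite e" using p_e[of 0] by simp
    ultimately show ?case by (rule finite_subset)
  next
    case (step1 i)
    have "range (\<lambda>n. p n (i + 1)) \<subseteq> (\<Union>v\<in>range (\<lambda>n. p n i). {y. {v, y} \<in> E})"
      using p_edge by auto
    moreover have "finite (\<Union>v\<in>range (\<lambda>n. p n i). {y. {v, y} \<in> E})"
      using step1 finite_neighbours[OF assms(1,2)] by blast
    ultimately show ?case by (rule finite_subset)
  next
    case (step2 i)
    have "{p n i, p n (i - 1)} \<in> E" for n using p_edge[of n "i - 1"] by (simp add: insert_commute)
    then have "range (\<lambda>n. p n (i - 1)) \<subseteq> (\<Union>v\<in>range (\<lambda>n. p n i). {y. {v, y} \<in> E})" by auto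
    moreover have "finite (\<Union>v\<in>range (\<lambda>n. p n i). {y. {v, y} \<in> E})"
      using step2 finite_neighbours[OF assms(1,2)] by blast
    ultimately show ?case by (rule finite_subset)
  qed
  then obtain r g where r: "strict_mono (r :: nat \<Rightarrow> nat)"
    and g: "\<And>i. \<forall>\<^sub>F n in sequentially. p (r n) i = g i"
    using pointwise_stabilising_subsequence[of p] by blast
  have freq_r: "\<exists>\<^sub>F n in sequentially. Q n" if "\<exists>\<^sub>F n in sequentially. Q (r n)" for Q
    using that eventually_subseq[OF r, of "\<lambda>n. \<not> Q n"] by (auto simp: frequently_def)
  have g_edge: "\<forall>\<^sub>F n in sequentially. {g i, g (i + 1)} = {p (r n) i, p (r n) (i + 1)}" for i
    using g[of i] g[of "i + 1"] by eventually_elim simp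
  have "\<forall>\<^sub>F n in sequentially. e = {g 0, g 1}"
    using g_edge[of 0] by eventually_elim (use p_e in simp)
  then have g_e: "e = {g 0, g 1}" by (simp add: eventually_const_iff)
  show thesis
  proof (cases "\<exists>l. \<exists>\<^sub>F n in sequentially. L (r n) = l")
    case True
    then obtain l where l: "\<exists>\<^sub>F n in sequentially. L (r n) = l" by blast
    \<comment> \<open>Walks of period \<open>l\<close> that agree with \<open>g\<close> on a full period all come from the same cycle.\<close>
    let ?D = "(\<lambda>i. {g i, g (i + 1)}) ` {0..int l}"
    have "\<forall>\<^sub>F n in sequentially. \<forall>i\<in>{0..int l}. {g i, g (i + 1)} = {p (r n) i, p (r n) (i + 1)}"
      using g_edge by (intro eventually_ball_finite) auto
    then have "\<forall>\<^sub>F n in sequentially. L (r n) = l \<longrightarrow> C (r n) = ?D"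
      by eventually_elim (auto simp: C_image intro!: image_cong)
    with l have D: "\<exists>\<^sub>F n in sequentially. C (r n) = ?D" by (rule frequently_rev_mp)
    then obtain n where n: "C (r n) = ?D" by (auto dest: frequently_ex)
    show thesis
    proof (rule that)
      show "?D \<in> cycles E \<union> biinfinite_paths E" "e \<in> ?D" using C[of "r n"] by (simp_all add: n)
      show "\<exists>\<^sub>F n in sequentially. f \<in> C n" if "f \<in> ?D" for f
        proof (rule freq_r)
        show "\<exists>\<^sub>F n in sequentially. f \<in> C (r n)"
          using that by (intro frequently_mono[OF _ D]) auto
      qed
    qed
  next
    case False
    have long: "\<forall>\<^sub>F n in sequentially. l < L (r n)" for l
    proof -
      have "\<forall>\<^sub>F n in sequentially. \<forall>k\<in>{..l}. L (r n) \<noteq> k"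
        using False by (intro eventually_ball_finite) (auto simp: frequently_def)
      then show ?thesis by eventually_elim (metis atMost_iff not_less)
    qed
    let ?D = "range (\<lambda>i. {g i, g (i + 1)})"
    \<comment> \<open>Distinct indices are incongruent modulo every period that exceeds their distance.\<close>
    have "inj g"
    proof (rule injI)
      fix i j assume ij: "g i = g j"
      have "\<forall>\<^sub>F n in sequentially. i = j"
        using g[of i] g[of j] long[of "nat \<bar>i - j\<bar>"]
      proof eventually_elim
        case (elim n)
        then have "int (L (r n)) dvd i - j" "\<bar>i - j\<bar> < int (L (r n))"
          using p_eq[of "r n" i j] ij by (auto simp: mod_eq_dvd_iff)
        then show ?case using dvd_imp_le_int[of "i - j" "int (L (r n))"] by fastforce
      qed
      then show "i = j" by (simp add: eventually_const_iff)
    qed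
    moreover have "{g i, g (i + 1)} \<in> E" for i
    proof -
      have "\<forall>\<^sub>F n in sequentially. {g i, g (i + 1)} \<in> E"
        using g_edge[of i] by eventually_elim (use p_edge in simp)
      then show ?thesis by (simp add: eventually_const_iff)
    qed
    ultimately have "?D \<in> biinfinite_paths E" by (auto simp: biinfinite_paths_def)
    moreover have "e \<in> ?D" using g_e by (auto intro: range_eqI[of _ _ 0])
    moreover have "\<exists>\<^sub>F n in sequentially. f \<in> C n" if "f \<in> ?D" for f
    proof -
      from that obtain i where f: "f = {g i, g (i + 1)}" by blast
      have "\<forall>\<^sub>F n in sequentially. f \<in> C (r n)"
        using g_edge[of i] by eventually_elim (simp add: f C_range)
      then have "\<exists>\<^sub>F n in sequentially. f \<in> C (r n)" by (intro eventually_frequently) auto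
      then show ?thesis by (rule freq_r)
    qed
    ultimately show thesis using that by blast
  qed
qed

text \<open>
  If \<open>e\<close> were deleted from the free forest for arbitrarily large \<open>\<beta>\<close>, it would be least on an
  accumulation point of the cycles responsible. This may be a bi-infinite path, which is why \<open>e\<close> has
  to survive in the wired forest of the limiting order and not only in the free one.
\<close>

lemma eventually_in_free_forest:
  assumes "simple_graph V E" "locally_finite_graph V E" "e \<in> wired_forest E prec"
    and closed: "\<And>e'. e' \<in> E \<Longrightarrow> \<not> prec e e' \<Longrightarrow> \<forall>\<^sub>F \<beta>::real in at_top. \<not> prec' \<beta> e e'"
  shows "\<forall>\<^sub>F \<beta> in at_top. e \<in> free_forest E (prec' \<beta>)"
proof (rule ccontr)
  assume "\<not> ?thesis"
  then have "\<exists>\<beta>\<ge>b. e \<notin> free_forest E (prec' \<beta>)" for b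
    by (auto simp: eventually_at_top_linorder)
  moreover have "e \<in> E" using assms(3) by (simp add: wired_forest_def free_forest_def)
  ultimately have "\<exists>\<beta>\<ge>b. \<exists>C\<in>cycles E. least_in (prec' \<beta>) C e" for b
    by (simp add: free_forest_def)
  then have "\<exists>\<beta> C. real n \<le> \<beta> \<and> C \<in> cycles E \<and> least_in (prec' \<beta>) C e" for n :: nat
    by meson
  then obtain \<beta> C where \<beta>: "\<And>n. real n \<le> \<beta> n" and C: "\<And>n. C n \<in> cycles E"
    and least: "\<And>n. least_in (prec' (\<beta> n)) (C n) e"
    by metis
  have lim: "filterlim \<beta> at_top sequentially"
    by (rule filterlim_at_top_mono[OF filterlim_real_sequentially]) (simp add: \<beta>)
  have "e \<in> C n" for n using least by (simp add: least_in_def)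
  then obtain D where D: "D \<in> cycles E \<union> biinfinite_paths E" "e \<in> D"
    and freq: "\<And>f. f \<in> D \<Longrightarrow> \<exists>\<^sub>F n in sequentially. f \<in> C n"
    using cycles_accumulate[of V E C e, OF assms(1,2) C] by blast
  have "prec e f" if "f \<in> D - {e}" for f
  proof (rule ccontr)
    assume not: "\<not> prec e f"
    have "f \<in> E" using frequently_ex[OF freq] that cycle_subset_edges[OF C] by blast
    then have "\<forall>\<^sub>F n in sequentially. \<not> prec' (\<beta> n) e f"
      using closed[OF _ not] lim by (auto dest: eventually_compose_filterlim)
    moreover have "\<exists>\<^sub>F n in sequentially. prec' (\<beta> n) e f"
      using freq[of f] by (rule frequently_mono[rotated]) (use that least in \<open>auto simp: least_in_def\<close>)
    ultimately show False by (simp add: frequently_def)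
  qed
  then have "least_in prec D e" using D(2) by (simp add: least_in_def)
  then show False using D(1) assms(3) by (auto simp: wired_forest_def free_forest_def)
qed

section \<open>The local limits\<close>

lemma AE_labels_less_1:
  assumes "iid_uniform_labels M E U" "countable E"
  shows "AE \<omega> in M. \<forall>e\<in>E. U e \<omega> < 1"
proof (rule AE_ball_countable'[OF _ assms(2)])
  fix e assume e: "e \<in> E"
  interpret prob_space M using assms(1) by (simp add: iid_uniform_labels_def)
  have meas: "U e \<in> borel_measurable M"
    using assms(1) e by (auto simp: iid_uniform_labels_def indep_vars_def)
  have distr: "distr M borel (U e) = uniform_measure lborel {0..1}"
    using assms(1) e by (simp add: iid_uniform_labels_def)
  have "AE x in uniform_measure lborel {0..1::real}. x < 1"
  proof (rule AE_uniform_measureI)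
    show "AE x in lborel. x \<in> {0..1::real} \<longrightarrow> x < 1"
      using AE_lborel_singleton[of "1::real"] by eventually_elim auto
  qed simp
  then show "AE \<omega> in M. U e \<omega> < 1"
    unfolding distr[symmetric] by (rule AE_distrD[OF meas])
qed

lemma F_beta_limit_at_0:
  assumes "\<And>e. e \<in> E \<Longrightarrow> 0 < edge_weight w e"
    and "is_local_limit E (\<lambda>\<beta>. W_beta E w \<beta> u) (FMSF E u) (at_right 0)"
  shows "is_local_limit E (\<lambda>\<beta>. F_beta E w \<beta> u) (FMSF E u) (at_right 0)"
proof (rule is_local_limitI)
  show "FMSF E u \<subseteq> E" by (auto simp: FMSF_def free_forest_def)
  show "\<forall>\<^sub>F \<beta> in at_right 0. e \<in> F_beta E w \<beta> u" if "e \<in> FMSF E u" for e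
    using is_local_limit_eventually_mem[OF assms(2) that]
    by eventually_elim (simp add: W_beta_def F_beta_def wired_forest_def)
  show "\<forall>\<^sub>F \<beta> in at_right 0. e \<notin> F_beta E w \<beta> u" if "e \<in> E" "e \<notin> FMSF E u" for e
    unfolding F_beta_def using that
    by (intro eventually_not_in_free_forest[where prec = "order_0 u"] order_0_imp_eventually_order_beta)
      (auto simp: FMSF_def assms(1))
qed

lemma F_beta_limit_at_top:
  assumes "simple_graph V E" "locally_finite_graph V E"
    and pos: "\<And>e. e \<in> E \<Longrightarrow> 0 < edge_weight w e" "\<And>e. e \<in> E \<Longrightarrow> u e < 1"
    and "WMaxSF E w u = FMaxSF E w u"
  shows "is_local_limit E (\<lambda>\<beta>. F_beta E w \<beta> u) (FMaxSF E w u) at_top"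
proof (rule is_local_limitI)
  show sub: "FMaxSF E w u \<subseteq> E" by (auto simp: FMaxSF_def free_forest_def)
  show "\<forall>\<^sub>F \<beta> in at_top. e \<in> F_beta E w \<beta> u" if "e \<in> FMaxSF E w u" for e
    unfolding F_beta_def
  proof (rule eventually_in_free_forest[OF assms(1,2)])
    show "e \<in> wired_forest E (order_w w u)" using that assms(5) by (simp add: WMaxSF_def)
    show "\<forall>\<^sub>F \<beta> in at_top. \<not> order_beta w \<beta> u e e'" if "e' \<in> E" "\<not> order_w w u e e'" for e'
      using that \<open>e \<in> FMaxSF E w u\<close> sub
      by (intro not_order_w_imp_eventually_not_order_beta pos) auto
  qed
  show "\<forall>\<^sub>F \<beta> in at_top. e \<notin> F_beta E w \<beta> u" if "e \<in> E" "e \<notin> FMaxSF E w u" for e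
    unfolding F_beta_def using that
    by (intro eventually_not_in_free_forest[where prec = "order_w w u"] order_w_imp_eventually_order_beta)
      (auto simp: FMaxSF_def pos)
qed

theorem theorem3p3:
  fixes V :: "'v set" and E :: "'v set set" and \<Gamma> :: "('v \<Rightarrow> 'v) set" and v0 :: 'v
    and M :: "'a measure" and U :: "'v set \<Rightarrow> 'a \<Rightarrow> real"
  assumes "simple_graph V E" and "locally_finite_graph V E" and "connected_graph V E"
    and "subgroup \<Gamma> (perm_group V (graph_automorphisms V E))"
    and "closedin (perm_topology V (graph_automorphisms V E)) \<Gamma>"
    and "nonunimodular (perm_group V \<Gamma>) (perm_topology V \<Gamma>)"
    and "transitive_on V \<Gamma>"
    and "v0 \<in> V"
    and "iid_uniform_labels M E U"
  shows
    "(\<forall>W0 :: 'a \<Rightarrow> 'v set set.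
        (AE \<omega> in M. is_local_limit E (\<lambda>\<beta>. W_beta E (rel_weight \<Gamma> v0) \<beta> (\<lambda>e. U e \<omega>))
                       (W0 \<omega>) (at_right 0)) \<longrightarrow>
        (AE \<omega> in M. W0 \<omega> = FMSF E (\<lambda>e. U e \<omega>)) \<longrightarrow>
        (AE \<omega> in M. is_local_limit E (\<lambda>\<beta>. F_beta E (rel_weight \<Gamma> v0) \<beta> (\<lambda>e. U e \<omega>))
                       (FMSF E (\<lambda>e. U e \<omega>)) (at_right 0))) \<and>
     ((AE \<omega> in M. WMaxSF E (rel_weight \<Gamma> v0) (\<lambda>e. U e \<omega>) = FMaxSF E (rel_weight \<Gamma> v0) (\<lambda>e. U e \<omega>)) \<longrightarrow>
        (AE \<omega> in M. is_local_limit E (\<lambda>\<beta>. F_beta E (rel_weight \<Gamma> v0) \<beta> (\<lambda>e. U e \<omega>))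
                       (FMaxSF E (rel_weight \<Gamma> v0) (\<lambda>e. U e \<omega>)) at_top))"
proof -
  let ?w = "rel_weight \<Gamma> v0"
  have pos: "0 < edge_weight ?w e" if "e \<in> E" for e
    using edge_weight_pos[OF assms(1) that] rel_weight_pos[OF assms(1-4) _ assms(8)] by blast
  have labels: "AE \<omega> in M. \<forall>e\<in>E. U e \<omega> < 1"
    using AE_labels_less_1[OF assms(9)] countable_edges[OF assms(1-3)] by blast
  show ?thesis
  proof (intro conjI allI impI)
    fix W0 :: "'a \<Rightarrow> 'v set set"
    assume "AE \<omega> in M. is_local_limit E (\<lambda>\<beta>. W_beta E ?w \<beta> (\<lambda>e. U e \<omega>)) (W0 \<omega>) (at_right 0)"
      and "AE \<omega> in M. W0 \<omega> = FMSF E (\<lambda>e. U e \<omega>)"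
    then show "AE \<omega> in M. is_local_limit E (\<lambda>\<beta>. F_beta E ?w \<beta> (\<lambda>e. U e \<omega>))
        (FMSF E (\<lambda>e. U e \<omega>)) (at_right 0)"
    proof eventually_elim
      case (elim \<omega>)
      then show ?case by (intro F_beta_limit_at_0 pos) auto
    qed
  next
    assume "AE \<omega> in M. WMaxSF E ?w (\<lambda>e. U e \<omega>) = FMaxSF E ?w (\<lambda>e. U e \<omega>)"
    with labels show "AE \<omega> in M. is_local_limit E (\<lambda>\<beta>. F_beta E ?w \<beta> (\<lambda>e. U e \<omega>))
        (FMaxSF E ?w (\<lambda>e. U e \<omega>)) at_top"
    proof eventually_elim
      case (elim \<omega>)
      then show ?case by (intro F_beta_limit_at_top[OF assms(1,2)] pos) auto
    qed
  qed
qed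

end
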